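(* Let $A_n=n!\,[2(n+1)H_n-4n]$ with $H_n=\sum_{i=1}^n\frac1i$ (the total number of pivot comparisons made by Quicksort over all $n!$ orderings of an array of size $n$), and let $L_n$ be the number of preference lists in $[n]^n$ with exactly $n-1$ lucky cars. Then both sequences $f_n=A_n$ and $f_n=L_n$ satisfy, for all $n\geq 2$, the recurrence $$f_n=2n f_{n-1}-n(n-1)f_{n-2}+2(n-1)!,$$ with $f_0=f_1=0$.
   Context: For $n\in\mathbb{N}$ let $[n]=\{1,\dots,n\}$. A preference list of length $n$ is a tuple $\alpha=(p_1,\dots,p_n)\in[n]^n$. Cars $1,2,\dots,n$ enter, in this order, a one-way street with parking spots $1,\dots,n$. Car $i$ parks in the first unoccupied spot numbered greater than or equal to $p_i$, if such a spot exists; otherwise car $i$ is unable to park (and the remaining cars continue in order). Car $i$ is lucky if it parks in its preferred spot $p_i$; a car that is unable to park is not lucky. $\mathrm{Lucky}(\alpha)$ is the number of lucky cars of $\alpha$. It is not required that all cars be able to park. Set $L_n=|\{\alpha\in[n]^n:\mathrm{Lucky}(\alpha)=n-1\}|$, with $L_0=0$. Quicksort: given an array of $n\ge 1$ elements, Quicksort selects a pivot element, makes $n-1$ pivot comparisons to split the other elements into a left array and a right array, and recurses on each. The expected number $Q_n$ of pivot comparisons on a uniformly random ordering is determined by $Q_0=0$ and $Q_n=(n-1)+\frac1n\sum_{k=1}^n (Q_{k-1}+Q_{n-k})$ for $n\geq 1$, with closed form $Q_n=2(n+1)H_n-4n$ (where $H_0=0$); and $A_n=n!\,Q_n$. *)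

theory Defs
  imports "HOL-Analysis.Analysis"
begin

text \<open>Preference lists are 0-indexed lists of spots, while the spots themselves are \<open>1, \<dots>, n\<close>.\<close>

definition preference_lists :: "nat \<Rightarrow> nat list set" where
  "preference_lists n = {\<alpha>. length \<alpha> = n \<and> set \<alpha> \<subseteq> {1..n}}"

definition parking_spot :: "nat \<Rightarrow> nat set \<Rightarrow> nat \<Rightarrow> nat option" where
  "parking_spot n occupied p =
     (let free = {s. p \<le> s \<and> s \<le> n \<and> s \<notin> occupied}
      in if free = {} then None else Some (Min free))"

text \<open>The spots obtained by successive cars on a street with \<open>n\<close> spots; \<open>None\<close> marks a car
  that is unable to park, which leaves the street unchanged.\<close>

primrec park_cars :: "nat \<Rightarrow> nat set \<Rightarrow> nat list \<Rightarrow> nat option list" where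
  "park_cars n occupied [] = []"
| "park_cars n occupied (p # ps) =
     (let s = parking_spot n occupied p
      in s # park_cars n (occupied \<union> set_option s) ps)"

definition outcome :: "nat list \<Rightarrow> nat option list" where
  "outcome \<alpha> = park_cars (length \<alpha>) {} \<alpha>"

definition lucky :: "nat list \<Rightarrow> nat" where
  "lucky \<alpha> = card {i. i < length \<alpha> \<and> outcome \<alpha> ! i = Some (\<alpha> ! i)}"

text \<open>The case \<open>n = 0\<close> is separate because \<open>n - 1\<close> truncates to \<open>0\<close> on the naturals.\<close>

definition one_unlucky_count :: "nat \<Rightarrow> nat" where
  "one_unlucky_count n =
     (if n = 0 then 0 else card {\<alpha> \<in> preference_lists n. lucky \<alpha> = n - 1})"

definition quicksort_expected :: "nat \<Rightarrow> real" where
  "quicksort_expected n = 2 * (real n + 1) * harm n - 4 * real n"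

definition quicksort_total :: "nat \<Rightarrow> real" where
  "quicksort_total n = fact n * quicksort_expected n"

text \<open>The closed form solves the Quicksort recurrence, which determines it uniquely.\<close>

lemma quicksort_expected_0: "quicksort_expected 0 = 0"
  by (simp add: quicksort_expected_def harm_def)

lemma sum_quicksort_expected:
  "(\<Sum>k<n. quicksort_expected k) =
     real n * (real n + 1) * harm n - 2 * real n ^ 2 - real n * (real n - 1) / 2"
proof (induction n)
  case (Suc n)
  have "harm n = harm (Suc n) - 1 / (real n + 1)"
    by (simp add: harm_Suc inverse_eq_divide add.commute)
  then have h: "(real n + 1) * harm n = (real n + 1) * harm (Suc n) - 1"
    by (simp add: right_diff_distrib)
  have "(\<Sum>k<Suc n. quicksort_expected k) =
      (real n + 2) * ((real n + 1) * harm n) - 2 * real n ^ 2 - real n * (real n - 1) / 2 - 4 * real n"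
    unfolding sum.lessThan_Suc Suc.IH unfolding quicksort_expected_def by (simp add: algebra_simps)
  then show ?case
    unfolding h by (simp add: field_simps power2_eq_square)
qed simp

lemma quicksort_expected_rec:
  assumes "n \<ge> 1"
  shows "quicksort_expected n = (real n - 1) +
    1 / real n * (\<Sum>k=1..n. quicksort_expected (k - 1) + quicksort_expected (n - k))"
proof -
  have l: "(\<Sum>k=1..n. quicksort_expected (k - 1)) = (\<Sum>k<n. quicksort_expected k)"
    by (rule sum.reindex_bij_witness[of _ Suc "\<lambda>k. k - 1"]) auto
  have r: "(\<Sum>k=1..n. quicksort_expected (n - k)) = (\<Sum>k<n. quicksort_expected k)"
    by (rule sum.reindex_bij_witness[of _ "\<lambda>k. n - k" "\<lambda>k. n - k"]) auto
  have "(\<Sum>k=1..n. quicksort_expected (k - 1) + quicksort_expected (n - k)) =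
      2 * (real n * (real n + 1) * harm n - 2 * real n ^ 2 - real n * (real n - 1) / 2)"
    unfolding sum.distrib l r sum_quicksort_expected by simp
  then show ?thesis
    using assms unfolding quicksort_expected_def by (simp add: field_simps power2_eq_square)
qed

end

theory Submission
  imports Defs "HOL-Combinatorics.Multiset_Permutations"
begin

text \<open>A list has exactly one unlucky car iff it is \<open>xs @ p # ys\<close> with \<open>xs\<close> distinct, \<open>p \<in> set xs\<close>, and
  \<open>ys\<close> a distinct list of spots that are still free. Fix \<open>k = length xs < n\<close>. If the car
  preferring \<open>p\<close> parks, there are \<open>(n - k - 1)!\<close> choices of \<open>ys\<close>; if it does not, i.e. if
  \<open>{p..n} \<subseteq> set xs\<close>, there are \<open>(n - k)!\<close>. The number of pairs of a \<open>k\<close>-set and a \<open>p\<close> of the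
  second kind is \<open>n choose (k - 1)\<close>, by the hockey-stick identity, so a given \<open>k\<close> contributes
  \<open>n! \<cdot> 2k / (n + 1 - k)\<close>. Summing over \<open>k\<close> gives \<open>n! (2 (n + 1) H\<^sub>n - 4n)\<close>, the Quicksort total.\<close>

section \<open>Where a single car parks\<close>

lemma parking_spot_lucky_iff:
  assumes "p \<le> n"
  shows "parking_spot n occ p = Some p \<longleftrightarrow> p \<notin> occ"
proof -
  let ?free = "{s. p \<le> s \<and> s \<le> n \<and> s \<notin> occ}"
  have fin: "finite ?free"
    by simp
  show ?thesis
  proof
    assume "parking_spot n occ p = Some p"
    then have "?free \<noteq> {}" "Min ?free = p"
      unfolding parking_spot_def Let_def by (auto split: if_splits)
    then have "p \<in> ?free"
      using Min_in[OF fin] by metis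
    then show "p \<notin> occ"
      by simp
  next
    assume "p \<notin> occ"
    then have "p \<in> ?free"
      using assms by simp
    moreover from this have "Min ?free = p"
      using fin by (intro Min_eqI) auto
    ultimately show "parking_spot n occ p = Some p"
      unfolding parking_spot_def Let_def by auto
  qed
qed

text \<open>\<open>set_option\<close> makes a failed attempt the empty set, so parking and failing
  are treated alike: the first part makes the lost spot a free one, the second says how many free
  spots are lost.\<close>

lemma set_parking_spot:
  assumes "p \<in> {1..n}"
  shows "set_option (parking_spot n occ p) \<subseteq> {1..n} - occ"
    and "card (set_option (parking_spot n occ p)) = (if {p..n} \<subseteq> occ then 0 else 1)"
proof -
  let ?free = "{s. p \<le> s \<and> s \<le> n \<and> s \<notin> occ}"
  have "Min ?free \<in> ?free" if "?free \<noteq> {}"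
    using that by (intro Min_in) auto
  then show "set_option (parking_spot n occ p) \<subseteq> {1..n} - occ"
    using assms unfolding parking_spot_def Let_def by (cases "?free = {}") auto
  have "?free = {} \<longleftrightarrow> {p..n} \<subseteq> occ"
    by auto
  then show "card (set_option (parking_spot n occ p)) = (if {p..n} \<subseteq> occ then 0 else 1)"
    unfolding parking_spot_def Let_def by (cases "?free = {}") (simp_all only: if_True if_False, auto)
qed

section \<open>The shape of lists with one unlucky car\<close>

text \<open>The street may start partly occupied, and pairs are filtered instead of indices, so that
  the first car can be peeled off in inductions.\<close>

definition unlucky_count :: "nat \<Rightarrow> nat set \<Rightarrow> nat list \<Rightarrow> nat" where
  "unlucky_count n occ ps = length (filter (\<lambda>(s, p). s \<noteq> Some p) (zip (park_cars n occ ps) ps))"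

lemma length_park_cars [simp]: "length (park_cars n occ ps) = length ps"
  by (induction ps arbitrary: occ) (simp_all add: Let_def)

lemma unlucky_count_Nil [simp]: "unlucky_count n occ [] = 0"
  by (simp add: unlucky_count_def)

lemma unlucky_count_Cons:
  assumes "p \<le> n"
  shows "unlucky_count n occ (p # ps) =
    (if p \<in> occ then Suc (unlucky_count n (occ \<union> set_option (parking_spot n occ p)) ps)
     else unlucky_count n (insert p occ) ps)"
  using parking_spot_lucky_iff[OF assms, of occ] by (auto simp: unlucky_count_def Let_def)

lemma lucky_plus_unlucky_count: "lucky \<alpha> + unlucky_count (length \<alpha>) {} \<alpha> = length \<alpha>"
proof -
  let ?z = "zip (outcome \<alpha>) \<alpha>"
  have len: "length (outcome \<alpha>) = length \<alpha>"
    by (simp add: outcome_def)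
  have "lucky \<alpha> = card {i. i < length ?z \<and> (case ?z ! i of (s, p) \<Rightarrow> s = Some p)}"
    unfolding lucky_def using len by (intro arg_cong[where f = card]) auto
  also have "\<dots> = length (filter (\<lambda>(s, p). s = Some p) ?z)"
    by (simp add: length_filter_conv_card)
  finally have "lucky \<alpha> = length (filter (\<lambda>(s, p). s = Some p) ?z)" .
  moreover have "unlucky_count (length \<alpha>) {} \<alpha> = length (filter (\<lambda>x. \<not> (case x of (s, p) \<Rightarrow> s = Some p)) ?z)"
    unfolding unlucky_count_def outcome_def by (intro arg_cong[where f = length] filter_cong) auto
  ultimately show ?thesis
    using sum_length_filter_compl[of "\<lambda>(s, p). s = Some p" ?z] len by simp
qed

text \<open>As long as all cars are lucky, the spots taken are exactly their preferences, so the
  next car is lucky iff its preference is new and outside \<open>occ\<close>.\<close>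

lemma unlucky_count_eq_0_iff:
  assumes "set ps \<subseteq> {1..n}"
  shows "unlucky_count n occ ps = 0 \<longleftrightarrow> distinct ps \<and> set ps \<inter> occ = {}"
  using assms
proof (induction ps arbitrary: occ)
  case (Cons p ps)
  then have "p \<le> n"
    by simp
  with Cons show ?case
    by (auto simp: unlucky_count_Cons)
qed simp

text \<open>Here \<open>p\<close> is the unlucky preference. The lucky cars before it occupy exactly
  \<open>set xs\<close>; those after it are all lucky on a street that has also lost the spot taken
  by the unlucky car, if any.\<close>

lemma unlucky_count_eq_1_iff:
  assumes "set ps \<subseteq> {1..n}"
  shows "unlucky_count n occ ps = 1 \<longleftrightarrow>
    (\<exists>xs p ys. ps = xs @ p # ys \<and> distinct xs \<and> set xs \<inter> occ = {} \<and> p \<in> occ \<union> set xs \<and>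
       distinct ys \<and>
       set ys \<inter> (occ \<union> set xs \<union> set_option (parking_spot n (occ \<union> set xs) p)) = {})"
    (is "_ \<longleftrightarrow> (\<exists>xs p ys. ?D occ ps xs p ys)")
  using assms
proof (induction ps arbitrary: occ)
  case (Cons q ps)
  then have q: "q \<le> n" and ps: "set ps \<subseteq> {1..n}"
    by auto
  show ?case
  proof (cases "q \<in> occ")
    case True
    \<comment> \<open>The first car is the unlucky one: a nonempty \<open>xs\<close> would start
      with \<open>q\<close>, yet avoid \<open>occ\<close>.\<close>
    have "(\<exists>xs p ys. ?D occ (q # ps) xs p ys) \<longleftrightarrow> ?D occ (q # ps) [] q ps"
    proof
      assume "\<exists>xs p ys. ?D occ (q # ps) xs p ys"
      then obtain xs p ys where D: "?D occ (q # ps) xs p ys"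
        by blast
      with True have "xs = []"
        by (cases xs) auto
      with D show "?D occ (q # ps) [] q ps"
        by simp
    qed blast
    then show ?thesis
      using True by (auto simp: unlucky_count_Cons[OF q] unlucky_count_eq_0_iff[OF ps])
  next
    case False
    \<comment> \<open>The first car is lucky, so it heads \<open>xs\<close>; moving it from
      \<open>xs\<close> to \<open>occ\<close> leaves \<open>occ \<union> set xs\<close>
      unchanged.\<close>
    have "(\<exists>xs p ys. ?D occ (q # ps) xs p ys) \<longleftrightarrow> (\<exists>xs p ys. ?D (insert q occ) ps xs p ys)"
    proof
      assume "\<exists>xs p ys. ?D occ (q # ps) xs p ys"
      then obtain xs p ys where D: "?D occ (q # ps) xs p ys"
        by blast
      with False obtain xs' where "xs = q # xs'"
        by (cases xs) auto
      with D have "?D (insert q occ) ps xs' p ys"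
        by auto
      then show "\<exists>xs p ys. ?D (insert q occ) ps xs p ys"
        by blast
    next
      assume "\<exists>xs p ys. ?D (insert q occ) ps xs p ys"
      then obtain xs p ys where "?D (insert q occ) ps xs p ys"
        by blast
      with False have "?D occ (q # ps) (q # xs) p ys"
        by auto
      then show "\<exists>xs p ys. ?D occ (q # ps) xs p ys"
        by blast
    qed
    then show ?thesis
      using False Cons.IH[OF ps] by (simp add: unlucky_count_Cons[OF q])
  qed
qed simp

section \<open>Counting lists without repetition\<close>

definition distinct_lists :: "nat \<Rightarrow> 'a set \<Rightarrow> 'a list set" where
  "distinct_lists k A = {xs. length xs = k \<and> distinct xs \<and> set xs \<subseteq> A}"

lemma finite_distinct_lists [simp]: "finite A \<Longrightarrow> finite (distinct_lists k A)"
  unfolding distinct_lists_def by (rule finite_subset[OF _ finite_lists_length_eq[of A k]]) blast+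

text \<open>Group the lists by their set of entries: each \<open>k\<close>-set has \<open>k!\<close>
  orderings.\<close>

lemma sum_distinct_lists:
  fixes g :: "'a set \<Rightarrow> real"
  assumes "finite A"
  shows "(\<Sum>xs\<in>distinct_lists k A. g (set xs)) = fact k * (\<Sum>S | S \<subseteq> A \<and> card S = k. g S)"
proof -
  have "(\<Sum>xs\<in>distinct_lists k A. g (set xs)) =
      (\<Sum>S | S \<subseteq> A \<and> card S = k. \<Sum>xs | xs \<in> distinct_lists k A \<and> set xs = S. g (set xs))"
  proof (rule sum.group[symmetric])
    show "set ` distinct_lists k A \<subseteq> {S. S \<subseteq> A \<and> card S = k}"
      by (auto simp: distinct_lists_def distinct_card)
  qed (use assms in auto)
  also have "\<dots> = (\<Sum>S | S \<subseteq> A \<and> card S = k. fact k * g S)"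
  proof (rule sum.cong[OF refl])
    fix S assume "S \<in> {S. S \<subseteq> A \<and> card S = k}"
    then have S: "S \<subseteq> A" "card S = k" "finite S"
      using assms finite_subset by auto
    have "{xs. xs \<in> distinct_lists k A \<and> set xs = S} = permutations_of_set S"
      using S by (auto simp: distinct_lists_def permutations_of_set_def distinct_card)
    moreover have "(\<Sum>xs\<in>permutations_of_set S. g (set xs)) = (\<Sum>xs\<in>permutations_of_set S. g S)"
      by (intro sum.cong) (auto simp: permutations_of_set_def)
    ultimately show "(\<Sum>xs | xs \<in> distinct_lists k A \<and> set xs = S. g (set xs)) = fact k * g S"
      using S by simp
  qed
  finally show ?thesis
    by (simp add: sum_distrib_left)
qed

lemma card_distinct_lists:
  assumes "finite A"
  shows "card (distinct_lists k A) = fact k * (card A choose k)"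
proof -
  have "real (card (distinct_lists k A)) = real (fact k * (card A choose k))"
    using sum_distinct_lists[OF assms, of "\<lambda>_. 1" k] n_subsets[OF assms, of k] by simp
  then show ?thesis
    by (simp only: of_nat_eq_iff)
qed

section \<open>Splitting at the unlucky car\<close>

definition unlucky_tails :: "nat \<Rightarrow> nat list \<Rightarrow> nat \<Rightarrow> nat list set" where
  "unlucky_tails n xs p =
     distinct_lists (n - Suc (length xs)) ({1..n} - set xs - set_option (parking_spot n (set xs) p))"

text \<open>The tail has \<open>n - k - 1\<close> cars. If the unlucky car parks, they fill all
  remaining free spots; otherwise \<open>n - k\<close> spots are free and one stays empty, which
  gives the extra factor \<open>n - k\<close>.\<close>

lemma card_unlucky_tails:
  assumes "xs \<in> distinct_lists k {1..n}" "k < n" "p \<in> set xs"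
  shows "card (unlucky_tails n xs p) =
    (if {p..n} \<subseteq> set xs then fact (n - k) else fact (n - Suc k))"
proof -
  let ?s = "set_option (parking_spot n (set xs) p)"
  have xs: "set xs \<subseteq> {1..n}" "card (set xs) = k" "length xs = k"
    using assms(1) by (auto simp: distinct_lists_def distinct_card)
  then have p: "p \<in> {1..n}"
    using assms(3) by auto
  have "card ({1..n} - set xs - ?s) = n - k - card ?s"
    using set_parking_spot(1)[OF p, of "set xs"] xs by (simp add: card_Diff_subset)
  then have "card ({1..n} - set xs - ?s) = (if {p..n} \<subseteq> set xs then n - k else n - Suc k)"
    using set_parking_spot(2)[OF p, of "set xs"] by (auto split: if_splits)
  moreover obtain m where "n - k = Suc m"
    using assms(2) by (metis Suc_diff_Suc)
  moreover from this have "n - Suc k = m"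
    by simp
  ultimately show ?thesis
    by (simp add: unlucky_tails_def card_distinct_lists xs)
qed

text \<open>The entry \<open>p\<close> is the first repetition in the list, which fixes where the
  list is cut.\<close>

lemma append_distinct_repetition_inj:
  assumes "xs @ p # ys = xs' @ p' # ys'" "distinct xs" "distinct xs'" "p \<in> set xs" "p' \<in> set xs'"
  shows "xs = xs' \<and> p = p' \<and> ys = ys'"
proof -
  \<comment> \<open>A shorter \<open>u\<close> would put \<open>u\<close> followed by
    \<open>a\<close> inside \<open>v\<close>, repeating \<open>a\<close> in a distinct list.\<close>
  have aux: "length u \<ge> length v"
    if "u @ a # w = v @ b # z" "distinct v" "a \<in> set u" for u v w z :: "'a list" and a b
  proof (rule ccontr)
    assume "\<not> length u \<ge> length v"
    with that(1) obtain t where "v = u @ a # t"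
      by (auto simp: append_eq_append_conv2 Cons_eq_append_conv)
    with that show False
      by auto
  qed
  have "length xs = length xs'"
    using aux[of xs p ys xs' p' ys'] aux[of xs' p' ys' xs p ys] assms by simp
  with assms(1) show ?thesis
    by simp
qed

text \<open>Concatenation is a bijection from the quadruples \<open>(k, xs, p, ys)\<close> onto the
  lists being counted.\<close>

lemma one_unlucky_count_eq_sum_card:
  "one_unlucky_count n =
     (\<Sum>k<n. \<Sum>xs\<in>distinct_lists k {1..n}. \<Sum>p\<in>set xs. card (unlucky_tails n xs p))"
proof (cases "n = 0")
  case False
  let ?X = "SIGMA k:{..<n}. SIGMA xs:distinct_lists k {1..n}. SIGMA p:set xs. unlucky_tails n xs p"
  have eq: "{\<alpha> \<in> preference_lists n. lucky \<alpha> = n - 1} =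
      {\<alpha>. length \<alpha> = n \<and> set \<alpha> \<subseteq> {1..n} \<and> unlucky_count n {} \<alpha> = 1}"
  proof (rule Collect_cong)
    fix \<alpha> :: "nat list"
    show "\<alpha> \<in> preference_lists n \<and> lucky \<alpha> = n - 1 \<longleftrightarrow>
        length \<alpha> = n \<and> set \<alpha> \<subseteq> {1..n} \<and> unlucky_count n {} \<alpha> = 1"
    proof (cases "length \<alpha> = n")
      case True
      \<comment> \<open>This relies on \<open>n > 0\<close>: for \<open>n = 0\<close> the truncated
        \<open>n - 1\<close> would make the left side true and the right side false.\<close>
      then have "lucky \<alpha> = n - 1 \<longleftrightarrow> unlucky_count n {} \<alpha> = 1"
        using lucky_plus_unlucky_count[of \<alpha>, unfolded True] False by arith
      with True show ?thesis
        by (simp add: preference_lists_def)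
    qed (simp add: preference_lists_def)
  qed
  have "bij_betw (\<lambda>(k, xs, p, ys). xs @ p # ys) ?X {\<alpha> \<in> preference_lists n. lucky \<alpha> = n - 1}"
    unfolding bij_betw_def
  proof
    show "inj_on (\<lambda>(k, xs, p, ys). xs @ p # ys) ?X"
    proof (rule inj_onI)
      fix u v
      assume uv: "u \<in> ?X" "v \<in> ?X" "(\<lambda>(k, xs, p, ys). xs @ p # ys) u = (\<lambda>(k, xs, p, ys). xs @ p # ys) v"
      obtain k xs p ys k' xs' p' ys' where "u = (k, xs, p, ys)" "v = (k', xs', p', ys')"
        by (cases u, cases v) blast
      with uv show "u = v"
        using append_distinct_repetition_inj[of xs p ys xs' p' ys'] by (simp add: distinct_lists_def)
    qed
    show "(\<lambda>(k, xs, p, ys). xs @ p # ys) ` ?X = {\<alpha> \<in> preference_lists n. lucky \<alpha> = n - 1}"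
      unfolding eq
    proof (intro equalityI subsetI)
      fix \<alpha> assume "\<alpha> \<in> (\<lambda>(k, xs, p, ys). xs @ p # ys) ` ?X"
      then obtain u where u: "u \<in> ?X" "\<alpha> = (\<lambda>(k, xs, p, ys). xs @ p # ys) u"
        by (rule imageE)
      moreover obtain k xs p ys where "u = (k, xs, p, ys)"
        by (cases u)
      ultimately have \<alpha>: "\<alpha> = xs @ p # ys" and mem: "k < n" "xs \<in> distinct_lists k {1..n}" "p \<in> set xs" "ys \<in> unlucky_tails n xs p"
        by simp_all
      then have len: "length \<alpha> = n" and set: "set \<alpha> \<subseteq> {1..n}"
        by (auto simp: distinct_lists_def unlucky_tails_def)
      have "distinct xs" "distinct ys" "set ys \<inter> (set xs \<union> set_option (parking_spot n (set xs) p)) = {}"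
        using mem by (auto simp: distinct_lists_def unlucky_tails_def)
      then have "unlucky_count n {} \<alpha> = 1"
        unfolding unlucky_count_eq_1_iff[OF set] using \<alpha> mem(3)
        by (intro exI[of _ xs] exI[of _ p] exI[of _ ys]) simp
      with len set show "\<alpha> \<in> {\<alpha>. length \<alpha> = n \<and> set \<alpha> \<subseteq> {1..n} \<and> unlucky_count n {} \<alpha> = 1}"
        by simp
    next
      fix \<alpha> assume "\<alpha> \<in> {\<alpha>. length \<alpha> = n \<and> set \<alpha> \<subseteq> {1..n} \<and> unlucky_count n {} \<alpha> = 1}"
      then have len: "length \<alpha> = n" and set: "set \<alpha> \<subseteq> {1..n}" and "unlucky_count n {} \<alpha> = 1"
        by auto
      then obtain xs p ys where \<alpha>: "\<alpha> = xs @ p # ys" and D: "distinct xs" "p \<in> set xs" "distinct ys"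
        "set ys \<inter> (set xs \<union> set_option (parking_spot n (set xs) p)) = {}"
        unfolding unlucky_count_eq_1_iff[OF set] by auto
      have "ys \<in> unlucky_tails n xs p"
        using D len set unfolding \<alpha> unlucky_tails_def distinct_lists_def by auto
      moreover have "xs \<in> distinct_lists (length xs) {1..n}" "length xs < n"
        using D len set by (auto simp: \<alpha> distinct_lists_def)
      ultimately have "(length xs, xs, p, ys) \<in> ?X"
        using D by simp
      then show "\<alpha> \<in> (\<lambda>(k, xs, p, ys). xs @ p # ys) ` ?X"
        by (rule rev_image_eqI) (simp add: \<alpha>)
    qed
  qed
  then have "one_unlucky_count n = card ?X"
    using False bij_betw_same_card by (fastforce simp: one_unlucky_count_def)
  also have "\<dots> = (\<Sum>k<n. \<Sum>xs\<in>distinct_lists k {1..n}. \<Sum>p\<in>set xs. card (unlucky_tails n xs p))"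
    by (simp add: card_SigmaI unlucky_tails_def)
  finally show ?thesis .
qed (simp add: one_unlucky_count_def)

section \<open>Preferences that cannot be served\<close>

lemma card_supersets_of_card:
  assumes "finite A" "B \<subseteq> A" "card B \<le> k"
  shows "card {S. B \<subseteq> S \<and> S \<subseteq> A \<and> card S = k} = (card A - card B) choose (k - card B)"
proof -
  have fin: "finite B" "finite (A - B)"
    using assms finite_subset by auto
  have "bij_betw (\<lambda>S. S - B) {S. B \<subseteq> S \<and> S \<subseteq> A \<and> card S = k} {T. T \<subseteq> A - B \<and> card T = k - card B}"
  proof (rule bij_betwI[where g = "\<lambda>T. T \<union> B"])
    show "(\<lambda>T. T \<union> B) \<in> {T. T \<subseteq> A - B \<and> card T = k - card B} \<rightarrow> {S. B \<subseteq> S \<and> S \<subseteq> A \<and> card S = k}"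
    proof safe
      fix T assume T: "T \<subseteq> A - B" "card T = k - card B"
      have "card (T \<union> B) = card T + card B"
        using T fin by (intro card_Un_disjoint) (auto intro: finite_subset)
      with T assms show "card (T \<union> B) = k"
        by simp
    qed (use assms in auto)
  qed (use fin in \<open>auto simp: card_Diff_subset\<close>)
  then have "card {S. B \<subseteq> S \<and> S \<subseteq> A \<and> card S = k} = card {T. T \<subseteq> A - B \<and> card T = k - card B}"
    by (rule bij_betw_same_card)
  with fin assms show ?thesis
    by (simp add: n_subsets card_Diff_subset)
qed

text \<open>A car preferring \<open>p\<close> cannot park iff \<open>{p..n}\<close> is occupied, so this counts the pairs of a
  \<open>k\<close>-set of occupied spots and a preference that fails on it.\<close>

lemma sum_card_blocked_preferences:
  assumes "k \<le> n" "k > 0"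
  shows "(\<Sum>S | S \<subseteq> {1..n} \<and> card S = k. card {p \<in> S. {p..n} \<subseteq> S}) = n choose (k - 1)"
proof -
  let ?K = "{S. S \<subseteq> {1..n} \<and> card S = k}"
  have finK: "finite ?K"
    by simp
  have "(\<Sum>S\<in>?K. card {p \<in> S. {p..n} \<subseteq> S}) = (\<Sum>S\<in>?K. card {p \<in> {1..n}. {p..n} \<subseteq> S})"
    by (intro sum.cong refl arg_cong[where f = card]) fastforce
  also have "\<dots> = (\<Sum>S\<in>?K. \<Sum>p\<in>{1..n}. if {p..n} \<subseteq> S then 1 else 0)"
    by (simp add: sum.If_cases Int_def)
  \<comment> \<open>Double counting: from here on, \<open>p\<close> is fixed and the
    \<open>k\<close>-sets containing \<open>{p..n}\<close> are counted.\<close>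
  also have "\<dots> = (\<Sum>p\<in>{1..n}. \<Sum>S\<in>?K. if {p..n} \<subseteq> S then 1 else 0)"
    by (rule sum.swap)
  also have "\<dots> = (\<Sum>p\<in>{1..n}. card {S. {p..n} \<subseteq> S \<and> S \<subseteq> {1..n} \<and> card S = k})"
    using finK by (intro sum.cong refl) (simp add: sum.If_cases Int_def conj_ac)
  \<comment> \<open>The interval \<open>{p..n}\<close> has \<open>n + 1 - p\<close> elements, so it
    fits into a \<open>k\<close>-set only if \<open>p \<ge> n + 1 - k\<close>.\<close>
  also have "\<dots> = (\<Sum>p\<in>{n - (k - 1)..n}. card {S. {p..n} \<subseteq> S \<and> S \<subseteq> {1..n} \<and> card S = k})"
  proof (rule sum.mono_neutral_right)
    show "\<forall>p\<in>{1..n} - {n - (k - 1)..n}. card {S. {p..n} \<subseteq> S \<and> S \<subseteq> {1..n} \<and> card S = k} = 0"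
    proof
      fix p assume p: "p \<in> {1..n} - {n - (k - 1)..n}"
      have "card S \<noteq> k" if S: "{p..n} \<subseteq> S" "S \<subseteq> {1..n}" for S
      proof -
        have "card {p..n} \<le> card S"
          using S by (intro card_mono) (auto intro: finite_subset)
        moreover have "p < n - (k - 1)"
          using p by auto
        ultimately show ?thesis
          using assms by simp
      qed
      then have "{S. {p..n} \<subseteq> S \<and> S \<subseteq> {1..n} \<and> card S = k} = {}"
        by blast
      then show "card {S. {p..n} \<subseteq> S \<and> S \<subseteq> {1..n} \<and> card S = k} = 0"
        by (simp only: card.empty)
    qed
  qed (use assms in auto)
  also have "\<dots> = (\<Sum>p\<in>{n - (k - 1)..n}. (p - 1) choose (k - (Suc n - p)))"
  proof (rule sum.cong[OF refl])
    fix p assume "p \<in> {n - (k - 1)..n}"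
    with assms show "card {S. {p..n} \<subseteq> S \<and> S \<subseteq> {1..n} \<and> card S = k} = (p - 1) choose (k - (Suc n - p))"
      by (subst card_supersets_of_card) auto
  qed
  \<comment> \<open>Substituting \<open>j = n - p\<close> gives the diagonal sum of the hockey-stick
    identity.\<close>
  also have "\<dots> = (\<Sum>j\<le>k - 1. (n - 1 - j) choose (k - 1 - j))"
    using assms by (intro sum.reindex_bij_witness[of _ "\<lambda>j. n - j" "\<lambda>p. n - p"]) auto
  also have "\<dots> = n choose (k - 1)"
    using sum_choose_diagonal[of "k - 1" "n - 1"] assms by simp
  finally show ?thesis .
qed

section \<open>Evaluating the count\<close>

lemma sum_card_unlucky_tails:
  assumes "k < n"
  shows "(\<Sum>xs\<in>distinct_lists k {1..n}. \<Sum>p\<in>set xs. real (card (unlucky_tails n xs p))) =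
    fact n * (2 * real k / (real n + 1 - real k))"
proof (cases "k = 0")
  case False
  \<comment> \<open>Each of the \<open>k\<close> choices of \<open>p\<close> contributes
    \<open>(n - k - 1)!\<close>, and a blocked one the surplus up to \<open>(n - k)!\<close>. The
    total depends on \<open>xs\<close> only through its set.\<close>
  define g where "g S = real k * fact (n - Suc k) +
    (fact (n - k) - fact (n - Suc k)) * real (card {p \<in> S. {p..n} \<subseteq> S})" for S :: "nat set"
  have "(\<Sum>p\<in>set xs. real (card (unlucky_tails n xs p))) = g (set xs)"
    if xs: "xs \<in> distinct_lists k {1..n}" for xs
  proof -
    have k: "card (set xs) = k"
      using xs by (auto simp: distinct_lists_def distinct_card)
    have "(\<Sum>p\<in>set xs. real (card (unlucky_tails n xs p))) =
        (\<Sum>p\<in>set xs. fact (n - Suc k) + (if {p..n} \<subseteq> set xs then fact (n - k) - fact (n - Suc k) else 0))"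
      using card_unlucky_tails[OF xs assms] by (intro sum.cong) auto
    also have "\<dots> = g (set xs)"
      by (simp add: sum.distrib k g_def sum.If_cases Int_def mult.commute)
    finally show ?thesis .
  qed
  then have "(\<Sum>xs\<in>distinct_lists k {1..n}. \<Sum>p\<in>set xs. real (card (unlucky_tails n xs p))) =
      fact k * (\<Sum>S | S \<subseteq> {1..n} \<and> card S = k. g S)"
    by (simp add: sum_distinct_lists[symmetric])
  also have "(\<Sum>S | S \<subseteq> {1..n} \<and> card S = k. g S) =
      real (n choose k) * (real k * fact (n - Suc k)) +
      (fact (n - k) - fact (n - Suc k)) * real (n choose (k - 1))"
    using sum_card_blocked_preferences[of k n] assms False
    by (simp add: g_def sum.distrib n_subsets flip: sum_distrib_left of_nat_sum)
  also have "fact k * \<dots> = fact n * (2 * real k / (real n + 1 - real k))"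
  proof -
    obtain m where m: "n - k = Suc m"
      using assms by (metis Suc_diff_Suc)
    obtain j where j: "k = Suc j"
      using False by (cases k) auto
    have m': "n - Suc k = m" "k - 1 = j" "n - j = Suc (Suc m)" "real n + 1 - real k = real m + 2"
      using m j assms by auto
    have f: "fact k = real k * fact j" "fact (n - k) = (real m + 1) * fact m"
      "fact (n - j) = (real m + 2) * (real m + 1) * fact m"
      unfolding m m' by (simp_all add: j algebra_simps)
    have "fact i * fact (n - i) * real (n choose i) = fact n" if "i \<le> n" for i
      using that by (simp add: binomial_fact)
    from this[of k] this[of j] have C: "fact k * fact (n - k) * real (n choose k) = fact n"
      "fact j * fact (n - j) * real (n choose j) = fact n"
      using assms j by linarith+
    let ?l = "fact k * (real (n choose k) * (real k * fact (n - Suc k)) +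
      (fact (n - k) - fact (n - Suc k)) * real (n choose (k - 1)))"
    \<comment> \<open>The multiplier completes both binomials to \<open>n!\<close>; the coefficients
      \<open>m + 2\<close> and \<open>m\<close> then add up to \<open>2 (m + 1)\<close>, and
      \<open>m + 1\<close> cancels.\<close>
    have "?l * ((real m + 2) * (real m + 1)) =
        (real m + 2) * real k * (fact k * fact (n - k) * real (n choose k)) +
        real k * real m * (fact j * fact (n - j) * real (n choose j))"
      unfolding m'(1,2) f by (simp add: algebra_simps)
    also have "\<dots> = fact n * 2 * real k * (real m + 1)"
      unfolding C by (simp add: algebra_simps)
    finally have "?l * (real m + 2) = fact n * 2 * real k"
      by (simp add: mult.assoc[symmetric] add_nonneg_eq_0_iff)
    then show ?thesis
      unfolding m' by (simp add: divide_simps)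
  qed
  finally show ?thesis .
qed (simp add: distinct_lists_def)

theorem one_unlucky_count_eq_quicksort_total: "real (one_unlucky_count n) = quicksort_total n"
proof -
  \<comment> \<open>As \<open>k\<close> runs below \<open>n\<close>, the denominator runs from
    \<open>n + 1\<close> down to \<open>2\<close>, so only the term \<open>1\<close> of the harmonic
    sum is missing.\<close>
  have h: "(\<Sum>k<n. 1 / (real n + 1 - real k)) = harm (Suc n) - 1"
  proof -
    have "(\<Sum>k<n. 1 / (real n + 1 - real k)) = (\<Sum>i\<in>{2..Suc n}. inverse (real i))"
      by (rule sum.reindex_bij_witness[of _ "\<lambda>i. Suc n - i" "\<lambda>k. Suc n - k"])
        (auto simp: of_nat_diff inverse_eq_divide add.commute)
    moreover have "(harm (Suc n) :: real) = 1 + (\<Sum>i\<in>{2..Suc n}. inverse (real i))"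
      unfolding harm_def by (subst sum.atLeast_Suc_atMost) (simp_all add: numeral_2_eq_2)
    ultimately show ?thesis
      by simp
  qed
  have "real (one_unlucky_count n) = (\<Sum>k<n. fact n * (2 * real k / (real n + 1 - real k)))"
    unfolding one_unlucky_count_eq_sum_card of_nat_sum
    by (intro sum.cong refl sum_card_unlucky_tails) simp
  \<comment> \<open>Writing \<open>k = (n + 1) - (n + 1 - k)\<close> in the numerator isolates the
    reciprocals.\<close>
  also have "\<dots> = fact n * (\<Sum>k<n. 2 * (real n + 1) * (1 / (real n + 1 - real k)) - 2)"
    unfolding sum_distrib_left by (intro sum.cong refl) (auto simp: field_simps)
  also have "\<dots> = fact n * (2 * (real n + 1) * (harm (Suc n) - 1) - 2 * real n)"
    unfolding sum_subtractf h[symmetric] sum_distrib_left[symmetric] by simp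
  also have "\<dots> = quicksort_total n"
    by (simp add: quicksort_total_def quicksort_expected_def harm_Suc divide_simps)
      (simp add: algebra_simps)
  finally show ?thesis .
qed

section \<open>The recurrence\<close>

lemma quicksort_total_rec:
  "quicksort_total (Suc (Suc n)) = 2 * real (n + 2) * quicksort_total (Suc n)
     - real (n + 2) * real (n + 1) * quicksort_total n + 2 * fact (Suc n)"
proof -
  \<comment> \<open>With names for the two reciprocals added to \<open>harm n\<close>, the claim
    becomes a polynomial identity modulo the relations \<open>ab\<close>.\<close>
  define x F H a b where "x = real n" "F = (fact n :: real)" "H = (harm n :: real)"
    "a = 1 / (x + 1)" "b = 1 / (x + 2)"
  note defs = this
  have ab: "(x + 1) * a = 1" "(x + 2) * b = 1"
    by (simp_all add: defs add_nonneg_eq_0_iff)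
  have 0: "quicksort_total n = F * (2 * (x + 1) * H - 4 * x)"
    by (simp add: quicksort_total_def quicksort_expected_def defs)
  have 1: "quicksort_total (Suc n) = (x + 1) * F * (2 * (x + 2) * (H + a) - 4 * (x + 1))"
    by (simp add: quicksort_total_def quicksort_expected_def defs harm_Suc inverse_eq_divide add_ac)
  have 2: "quicksort_total (Suc (Suc n)) =
      (x + 2) * (x + 1) * F * (2 * (x + 3) * (H + a + b) - 4 * (x + 2))"
    by (simp add: quicksort_total_def quicksort_expected_def defs harm_Suc inverse_eq_divide add_ac)
  have 3: "real (n + 2) = x + 2" "real (n + 1) = x + 1" "(fact (Suc n) :: real) = (x + 1) * F"
    by (simp_all add: defs algebra_simps)
  show ?thesis
    unfolding 0 1 2 3 using ab by algebra
qed

theorem mainTheorem2: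
  fixes f :: "nat \<Rightarrow> real"
  assumes "f = quicksort_total \<or> f = (\<lambda>n. real (one_unlucky_count n))"
  shows "f 0 = 0 \<and> f 1 = 0 \<and>
    (\<forall>n\<ge>2. f n = 2 * real n * f (n - 1) - real n * (real n - 1) * f (n - 2) + 2 * fact (n - 1))"
proof -
  \<comment> \<open>The two sequences coincide, so the closed form settles both cases.\<close>
  have f: "f = quicksort_total"
    using assms by (auto simp: one_unlucky_count_eq_quicksort_total)
  have "f n = 2 * real n * f (n - 1) - real n * (real n - 1) * f (n - 2) + 2 * fact (n - 1)"
    if "n \<ge> 2" for n
  proof -
    from that obtain m where "n = m + 2"
      by (auto simp: le_iff_add add.commute)
    then show ?thesis
      using quicksort_total_rec[of m] by (simp add: f)
  qed
  moreover have "f 0 = 0" "f 1 = 0"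
    by (simp_all add: f quicksort_total_def quicksort_expected_def harm_def)
  ultimately show ?thesis
    by blast
qed

end
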